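(* Let $a\ge2$ be an integer, $0<\alpha,\beta<1$, and $\tau$ in the complex upper half-plane. Then $$\mathcal{E}_{2-a}\left((1-\beta)\tau+\alpha;\tau\right)-(-\tau)^{a-2}\,\mathcal{E}_{2-a}\left(-\frac{\alpha}{\tau}+\beta;-\frac1\tau\right)=(2\pi i)^{a-1}\sum_{n=0}^{a}\frac{(-1)^nB_n(\beta)B_{a-n}(\alpha)}{n!\,(a-n)!}\,\tau^{n-1}.$$
   Context: For $a\in\mathbb{Z}$, $\tau=u+iv$ with $v>0$, and $z=x+iy$ with $0<y<v$, put $q=e^{2\pi i\tau}$, $\zeta=e^{2\pi i z}$ and $$\mathcal{E}_{2-a}(z;\tau)=\sum_{n\in\mathbb{Z}\setminus\{0\}}\frac{\zeta^n}{n^{a-1}(1-q^n)}.$$ $B_n(t)$ is the $n$-th Bernoulli polynomial, defined by $\sum_{n\ge0}B_n(x)\frac{t^n}{n!}=\frac{te^{xt}}{e^t-1}$. *)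

theory Defs
  imports "HOL-Analysis.Analysis" "HOL-Computational_Algebra.Formal_Power_Series"
begin

(* B_n(x) / n! is the n-th coefficient of the formal power series t e^{xt} / (e^t - 1);
   fps_exp x is e^{xt}.  The denominator has no constant term, but the quotient is exact:
   this is Bernoulli_poly_generating_function. *)
definition Bernoulli_poly :: "nat \<Rightarrow> 'a :: field_char_0 \<Rightarrow> 'a" where
  "Bernoulli_poly n x = fact n * fps_nth (fps_X * fps_exp x / (fps_exp 1 - 1)) n"

lemma Bernoulli_poly_generating_function:
  fixes x :: "'a :: field_char_0"
  shows "Abs_fps (\<lambda>n. Bernoulli_poly n x / fact n) * (fps_exp 1 - 1) = fps_X * fps_exp x"
proof -
  let ?g = "fps_exp (1::'a) - 1"
  have g1: "fps_nth ?g 1 = 1" by simp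
  hence nz: "?g \<noteq> 0" by (metis fps_zero_nth zero_neq_one)
  have sg: "subdegree ?g = 1" by (rule subdegreeI) auto
  have sf: "1 \<le> subdegree (fps_X * fps_exp x)"
    by (subst subdegree_mult) (auto dest: arg_cong[where f = "\<lambda>f. fps_nth f 0"])
  have "?g dvd fps_X * fps_exp x"
    using sg sf nz by (subst fps_dvd_iff) (auto dest: arg_cong[where f = "\<lambda>f. fps_nth f 0"])
  moreover have "Abs_fps (\<lambda>n. Bernoulli_poly n x / fact n) = fps_X * fps_exp x / ?g"
    by (rule fps_ext) (simp add: Bernoulli_poly_def)
  ultimately show ?thesis by simp
qed

(* calE k z \<tau> is E_k(z;\<tau>), used for k = 2 - a, so that n^{a-1} is n^{1-k}.
   It is meaningful for 0 < Im z < Im \<tau>, where the series converges absolutely. *)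
definition calE :: "int \<Rightarrow> complex \<Rightarrow> complex \<Rightarrow> complex" where
  "calE k z \<tau> =
     (let q = exp (2 * of_real pi * \<i> * \<tau>); \<zeta> = exp (2 * of_real pi * \<i> * z)
      in \<Sum>\<^sub>\<infinity>n\<in>UNIV - {0::int}. \<zeta> powi n / (of_int n powi (1 - k) * (1 - q powi n)))"

end

theory Submission
  imports Defs "HOL-Complex_Analysis.Complex_Analysis"
begin

text \<open>
  Put \<open>K\<^sub>x(s) = t e\<^sup>x\<^sup>t / (e\<^sup>t - 1)\<close> with \<open>t = 2\<pi>is\<close>, and integrate
  \<open>K\<^sub>\<alpha>(w) K\<^sub>\<beta>(-\<tau>w) / w\<^sup>a\<^sup>+\<^sup>1\<close> over large circles around 0. The poles are the nonzero integers, whose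
  residues add up to the first Eisenstein-type series, the nonzero multiples of \<open>1/\<tau>\<close>, whose
  residues add up to the second one, and 0, whose residue is the sum of Bernoulli polynomials (all up to constant factors).
  For \<open>0 < x < 1\<close> the quotient \<open>K\<^sub>x(s)/s\<close> decays exponentially in \<open>\<bar>Im s\<bar>\<close>; since \<open>w\<close> and \<open>\<tau>w\<close> cannot
  both be nearly real, the integrand is exponentially small on circles whose radii stay away
  from all multiples of 1 and of \<open>1/\<bar>\<tau>\<bar>\<close>.
\<close>

section \<open>Circles that stay away from two families of multiples\<close>

text \<open>Let p be the smaller number. Between consecutive multiples of p, take the points at one
  quarter and at three quarters of the gap. Both keep distance p/4 from the multiples of p, and they
  are p/2 apart, so they cannot both be within p/8 of multiples of q, which are at least p apart. It
  matters that \<delta> does not depend on N: the kernel estimates must be uniform over all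
  circles.\<close>

lemma radii_avoiding_multiples:
  fixes p q :: real
  assumes "p > 0" "q > 0"
  shows "\<exists>\<delta>>0. \<forall>N. \<exists>R\<ge>N. \<forall>n::int. \<delta> \<le> \<bar>R - n * p\<bar> \<and> \<delta> \<le> \<bar>R - n * q\<bar>"
  using assms
proof (induction p q rule: linorder_wlog)
  case (sym p q)
  then show ?case by (simp add: conj_commute)
next
  case (le p q)
  have "\<exists>R\<ge>N. \<forall>n::int. p / 8 \<le> \<bar>R - n * p\<bar> \<and> p / 8 \<le> \<bar>R - n * q\<bar>" for N
  proof -
    define j where "j = \<lceil>N / p\<rceil>"
    have j: "N \<le> j * p"
      using le by (simp add: j_def pos_divide_le_eq [symmetric])
    define R1 where "R1 = j * p + p / 4"
    define R2 where "R2 = j * p + 3 * p / 4"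
    have far: "p / 8 \<le> \<bar>j * p + c * p - n * p\<bar>" if "1 / 4 \<le> c" "c \<le> 3 / 4" for c and n :: int
    proof -
      have "1 / 8 \<le> \<bar>real_of_int (j - n) + c\<bar>"
      proof (cases "j - n \<ge> 0")
        case True
        hence "real_of_int (j - n) \<ge> 0" by linarith
        with that show ?thesis by linarith
      next
        case False
        hence "real_of_int (j - n) \<le> -1" by linarith
        with that show ?thesis by linarith
      qed
      hence "1 / 8 * p \<le> \<bar>real_of_int (j - n) + c\<bar> * p"
        using le by (intro mult_right_mono) auto
      also have "\<dots> = \<bar>(real_of_int (j - n) + c) * p\<bar>"
        using le by (simp add: abs_mult)
      finally show ?thesis by (simp add: algebra_simps)
    qed
    have far1: "p / 8 \<le> \<bar>R1 - n * p\<bar>" and far2: "p / 8 \<le> \<bar>R2 - n * p\<bar>" for n :: int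
      using far[of "1/4" n] far[of "3/4" n] by (simp_all add: R1_def R2_def)
    have "(\<forall>n::int. p / 8 \<le> \<bar>R1 - n * q\<bar>) \<or> (\<forall>n::int. p / 8 \<le> \<bar>R2 - n * q\<bar>)"
    proof (rule ccontr)
      assume "\<not> ?thesis"
      then obtain m m' :: int where m: "\<bar>R1 - m * q\<bar> < p / 8" "\<bar>R2 - m' * q\<bar> < p / 8"
        by (auto simp: not_le)
      have "R2 - R1 = p / 2" by (simp add: R1_def R2_def)
      \<comment> \<open>The two multiples of q are p/2 apart up to an error below p/4, so their
        distance lies strictly between p/4 and 3p/4. This makes them distinct, yet closer than
        q.\<close>
      hence *: "\<bar>m' * q - m * q\<bar> < 3 * p / 4" and ne: "m * q \<noteq> m' * q"
        using m le by linarith+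
      from ne have "\<bar>m' - m\<bar> \<ge> 1" by auto
      hence "\<bar>real_of_int (m' - m)\<bar> \<ge> 1" by linarith
      hence "1 * q \<le> \<bar>real_of_int (m' - m)\<bar> * q"
        using le by (intro mult_right_mono) auto
      also have "\<dots> = \<bar>m' * q - m * q\<bar>"
        using le by (simp add: abs_mult flip: left_diff_distrib)
      finally show False using * le by linarith
    qed
    moreover have "N \<le> R1" "N \<le> R2"
      using j le by (auto simp: R1_def R2_def)
    ultimately show ?thesis using far1 far2 by blast
  qed
  thus ?case using le by (intro exI[of _ "p / 8"]) auto
qed

section \<open>The generating function of the Bernoulli polynomials\<close>

text \<open>By periodicity, t can be moved into the rectangle \<open>[-1,1] x [-pi,pi]\<close>.
  There the only zero of exp t - 1 is 0, so the modulus has a positive minimum once a disc around 0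
  is removed.\<close>

lemma exp_minus_one_lower_bound:
  assumes "\<delta> > 0"
  shows "\<exists>C>0. \<forall>t. \<bar>Re t\<bar> \<le> 1 \<longrightarrow> (\<forall>n::int. \<delta> \<le> norm (t - 2 * pi * \<i> * n)) \<longrightarrow> C \<le> norm (exp t - 1)"
proof -
  define K where "K = cbox (Complex (-1) (-pi)) (Complex 1 pi) - ball 0 \<delta>"
  have "compact K"
    unfolding K_def by (intro compact_diff) auto
  have nz: "exp t - 1 \<noteq> 0" if "t \<in> K" for t
  proof
    assume "exp t - 1 = 0"
    then obtain n :: int where n: "Re t = 0" "Im t = of_int (2 * n) * pi"
      by (auto simp: exp_eq_1)
    have "\<bar>Im t\<bar> \<le> pi" using that by (auto simp: K_def in_cbox_complex_iff)
    hence "\<bar>real_of_int (2 * n)\<bar> * pi \<le> 1 * pi" using n by (simp add: abs_mult)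
    hence "\<bar>real_of_int (2 * n)\<bar> \<le> 1"
      using pi_gt_zero mult_le_cancel_right_pos by blast
    hence "n = 0" by linarith
    hence "t = 0" using n by (simp add: complex_eq_iff)
    thus False using that assms by (simp add: K_def)
  qed
  obtain C where C: "C > 0" "\<And>t. t \<in> K \<Longrightarrow> C \<le> norm (exp t - 1)"
  \<comment> \<open>For large \<delta> the removed disc swallows the rectangle; any positive
    constant then works, and 1 is taken.\<close>
  proof (cases "K = {}")
    case False
    have "continuous_on K (\<lambda>t. norm (exp t - 1))" by (intro continuous_intros)
    from continuous_attains_inf[OF \<open>compact K\<close> False this]
    obtain t0 where "t0 \<in> K" "\<And>t. t \<in> K \<Longrightarrow> norm (exp t0 - 1) \<le> norm (exp t - 1)"
      by blast
    thus ?thesis using nz by (intro that[of "norm (exp t0 - 1)"]) auto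
  qed (use that[of 1] in auto)
  show ?thesis
  proof (intro exI conjI allI impI)
    fix t assume t: "\<bar>Re t\<bar> \<le> 1" "\<forall>n::int. \<delta> \<le> norm (t - 2 * pi * \<i> * n)"
    \<comment> \<open>Subtracting the nearest multiple of 2 pi i leaves an imaginary part of
      absolute value at most pi.\<close>
    define n where "n = round (Im t / (2 * pi))"
    define s where "s = t - 2 * pi * \<i> * of_int n"
    have "\<bar>Im t / (2 * pi) - n\<bar> \<le> 1 / 2"
      unfolding n_def using of_int_round_abs_le by (metis abs_minus_commute)
    hence "\<bar>Im t / (2 * pi) - n\<bar> * (2 * pi) \<le> 1 / 2 * (2 * pi)"
      by (intro mult_right_mono) auto
    also have "\<bar>Im t / (2 * pi) - n\<bar> * (2 * pi) = \<bar>(Im t / (2 * pi) - n) * (2 * pi)\<bar>"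
      by (simp add: abs_mult)
    also have "\<dots> = \<bar>Im s\<bar>" by (simp add: s_def algebra_simps)
    finally have "s \<in> K"
      using t(1) t(2)[rule_format, of n] by (auto simp: K_def s_def in_cbox_complex_iff abs_le_iff)
    moreover have "exp s = exp t"
      using exp_plus_2pin[of s n] by (simp add: s_def mult_ac)
    ultimately show "C \<le> norm (exp t - 1)" using C by metis
  qed (use C in auto)
qed

text \<open>The value 1 fills the removable singularity at 0, so that the Taylor coefficients there
  are the Bernoulli polynomials divided by factorials.\<close>

definition bernoulli_kernel :: "complex \<Rightarrow> complex \<Rightarrow> complex" where
  "bernoulli_kernel x t = (if t = 0 then 1 else t * exp (x * t) / (exp t - 1))"

text \<open>Away from the imaginary axis, exp t - 1 is at least half as large as its dominant term,
  which is exp t on the right and 1 on the left. Hence the quotient decays at rate 1 - x on the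
  right and x on the left. This is where 0 < x < 1 is essential.\<close>

lemma norm_exp_over_exp_minus_one_le:
  fixes x :: real and t :: complex
  assumes x: "0 < x" "x < 1" and "\<bar>Re t\<bar> > 1"
  shows "norm (exp (x * t) / (exp t - 1)) \<le> 2 * exp (- (min x (1 - x) * \<bar>Re t\<bar>))"
proof -
  have e: "exp (-1::real) \<le> 1 / 2"
    using exp_ge_add_one_self[of "1::real"] by (simp add: exp_minus field_simps)
  define m where "m = max 1 (exp (Re t))"
  have "m / 2 \<le> \<bar>norm (exp t) - norm (1::complex)\<bar>"
  proof (cases "Re t > 1")
    case True
    hence "exp (- Re t) \<le> exp (-1)" by simp
    hence "exp (- Re t) \<le> 1 / 2" using e by (rule order_trans)
    hence "1 \<le> exp (Re t) / 2" by (simp add: exp_minus field_simps)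
    thus ?thesis using True by (auto simp: m_def abs_if)
  next
    case False
    hence "exp (Re t) \<le> exp (-1)" using assms by simp
    hence "exp (Re t) \<le> 1 / 2" using e by (rule order_trans)
    moreover have "max 1 e / 2 \<le> \<bar>e - 1\<bar>" if "e \<le> 1 / 2" for e :: real
      using that by linarith
    ultimately show ?thesis unfolding m_def norm_exp_eq_Re norm_one by blast
  qed
  also have "\<dots> \<le> norm (exp t - 1)" by (rule norm_triangle_ineq3)
  finally have m: "m / 2 \<le> norm (exp t - 1)" .
  have mpos: "m > 0" by (simp add: m_def)
  have "norm (exp (x * t) / (exp t - 1)) \<le> exp (x * Re t) / (m / 2)"
    unfolding norm_divide using m mpos by (intro frac_le) auto
  also have "\<dots> = 2 * (exp (x * Re t) / m)" by simp
  also have "exp (x * Re t) / m \<le> exp (- (min x (1 - x) * \<bar>Re t\<bar>))"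
  proof (cases "Re t > 1")
    case True
    have "min x (1 - x) * \<bar>Re t\<bar> \<le> (1 - x) * Re t"
      using True by (simp add: mult_right_mono)
    hence "exp (x * Re t) / exp (Re t) \<le> exp (- (min x (1 - x) * \<bar>Re t\<bar>))"
      by (simp add: algebra_simps flip: exp_diff)
    moreover have "m = exp (Re t)" using True by (simp add: m_def max_def)
    ultimately show ?thesis by simp
  next
    case False
    hence neg: "Re t < 0" using assms by linarith
    have "min x (1 - x) * \<bar>Re t\<bar> \<le> x * \<bar>Re t\<bar>"
      by (intro mult_right_mono) auto
    also have "\<dots> = - (x * Re t)" using neg by simp
    finally have "exp (x * Re t) \<le> exp (- (min x (1 - x) * \<bar>Re t\<bar>))" by simp
    moreover have "m = 1" using neg by (simp add: m_def max_def)
    ultimately show ?thesis by simp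
  qed
  finally show ?thesis by simp
qed

lemma bernoulli_kernel_decay:
  fixes x \<delta> :: real
  assumes x: "0 < x" "x < 1" and \<delta>: "\<delta> > 0"
  shows "\<exists>C>0. \<forall>t. (\<forall>n::int. \<delta> \<le> norm (t - 2 * pi * \<i> * n)) \<longrightarrow>
           norm (bernoulli_kernel x t) \<le> C * norm t * exp (- (min x (1 - x) * \<bar>Re t\<bar>))"
proof -
  define c where "c = min x (1 - x)"
  have c: "0 < c" "c \<le> 1" using x by (auto simp: c_def)
  from exp_minus_one_lower_bound[OF \<delta>] obtain K where K: "K > 0"
    "\<And>t. \<bar>Re t\<bar> \<le> 1 \<Longrightarrow> \<forall>n::int. \<delta> \<le> norm (t - 2 * pi * \<i> * n) \<Longrightarrow> K \<le> norm (exp t - 1)"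
    by blast
  \<comment> \<open>The summand 2 serves |Re t| > 1. For |Re t| <= 1 the numerator is at most e in
    modulus, the denominator at least \<open>K\<close>, and the decay factor at least 1/e, which
    gives \<open>exp 2 / K\<close>.\<close>
  define C where "C = 2 + exp 2 / K"
  have "C > 0" using K by (simp add: C_def add_pos_pos)
  have "norm (bernoulli_kernel x t) \<le> C * norm t * exp (- (c * \<bar>Re t\<bar>))"
    if t: "\<forall>n::int. \<delta> \<le> norm (t - 2 * pi * \<i> * n)" for t
  proof -
    have "t \<noteq> 0" using t[rule_format, of 0] \<delta> by auto
    have "norm (exp (x * t) / (exp t - 1)) \<le> C * exp (- (c * \<bar>Re t\<bar>))"
    proof (cases "\<bar>Re t\<bar> > 1")
      case True
      have "2 \<le> C" using K by (simp add: C_def)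
      hence "2 * exp (- (c * \<bar>Re t\<bar>)) \<le> C * exp (- (c * \<bar>Re t\<bar>))"
        by (intro mult_right_mono) auto
      with norm_exp_over_exp_minus_one_le[OF x True] show ?thesis
        unfolding c_def by (rule order_trans)
    next
      case False
      hence le: "\<bar>Re t\<bar> \<le> 1" by simp
      have "x * Re t \<le> x * \<bar>Re t\<bar>" using x by (intro mult_left_mono) auto
      also have "\<dots> \<le> 1 * 1" using le x by (intro mult_mono) auto
      finally have "x * Re t \<le> 1" by simp
      moreover have "c * \<bar>Re t\<bar> \<le> 1 * 1" using c le by (intro mult_mono) auto
      ultimately have "x * Re t \<le> 2 + - (c * \<bar>Re t\<bar>)" by linarith
      hence "exp (x * Re t) \<le> exp 2 * exp (- (c * \<bar>Re t\<bar>))"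
        unfolding exp_add [symmetric] by simp
      hence "norm (exp (x * t) / (exp t - 1)) \<le> exp 2 * exp (- (c * \<bar>Re t\<bar>)) / K"
        unfolding norm_divide using K(1) K(2)[OF le t] by (intro frac_le) auto
      also have "\<dots> \<le> C * exp (- (c * \<bar>Re t\<bar>))"
        using K by (simp add: C_def field_simps)
      finally show ?thesis .
    qed
    hence "norm t * norm (exp (x * t) / (exp t - 1)) \<le> norm t * (C * exp (- (c * \<bar>Re t\<bar>)))"
      by (intro mult_left_mono) auto
    thus ?thesis using \<open>t \<noteq> 0\<close>
      by (simp add: bernoulli_kernel_def norm_mult norm_divide mult_ac)
  qed
  thus ?thesis using \<open>C > 0\<close> by (auto simp: c_def)
qed

text \<open>Numerator and denominator both have a simple zero at 0 with leading coefficient 1, so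
  the formal quotient is the expansion of the function whose value at 0 is set to 1.\<close>

lemma has_fps_expansion_bernoulli_kernel:
  "bernoulli_kernel x has_fps_expansion Abs_fps (\<lambda>n. Bernoulli_poly n x / fact n)"
proof -
  let ?F = "fps_X * fps_exp x :: complex fps" and ?G = "fps_exp 1 - 1 :: complex fps"
  have sg: "subdegree ?G = 1" by (rule subdegreeI) auto
  have nz: "?G \<noteq> 0" using sg by force
  have sf: "subdegree ?F = 1" by (rule subdegreeI) auto
  have "(\<lambda>t. if t = 0 then 1 else t * exp (x * t) / (exp t - 1)) has_fps_expansion ?F / ?G"
    by (intro has_fps_expansion_divide fps_expansion_intros) (use sf sg nz in auto)
  also have "?F / ?G = Abs_fps (\<lambda>n. Bernoulli_poly n x / fact n)"
    by (rule fps_ext) (simp add: Bernoulli_poly_def)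
  finally show ?thesis by (simp add: bernoulli_kernel_def [abs_def])
qed

lemma bernoulli_kernel_holomorphic:
  "bernoulli_kernel x holomorphic_on {t. \<forall>n::int. n \<noteq> 0 \<longrightarrow> t \<noteq> 2 * pi * \<i> * n}"
    (is "_ holomorphic_on ?S")
proof -
  have "bernoulli_kernel x analytic_on {t}" if "t \<in> ?S" for t
  proof (cases "t = 0")
    case True
    from has_fps_expansion_imp_holomorphic[OF has_fps_expansion_bernoulli_kernel[of x]]
    obtain s where "open s" "0 \<in> s" "bernoulli_kernel x holomorphic_on s" by metis
    thus ?thesis using True by (auto simp: analytic_at)
  next
    case False
    have "exp t \<noteq> 1"
    proof
      assume "exp t = 1"
      then obtain n :: int where n: "Re t = 0" "Im t = of_int (2 * n) * pi"
        by (auto simp: exp_eq_1)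
      hence "t = 2 * pi * \<i> * n" by (simp add: complex_eq_iff)
      with that False show False by auto
    qed
    hence "(\<lambda>t. t * exp (x * t) / (exp t - 1)) analytic_on {t}"
      by (auto intro!: analytic_intros)
    moreover have "eventually (\<lambda>u. bernoulli_kernel x u = u * exp (x * u) / (exp u - 1)) (nhds t)"
      using t1_space_nhds[OF False] by eventually_elim (simp add: bernoulli_kernel_def)
    ultimately show ?thesis by (simp cong: analytic_at_cong)
  qed
  hence "bernoulli_kernel x analytic_on ?S" using analytic_on_analytic_at by blast
  thus ?thesis by (rule analytic_imp_holomorphic)
qed

section \<open>The rescaled kernel with poles at the nonzero integers\<close>

definition lattice_kernel :: "complex \<Rightarrow> complex \<Rightarrow> complex" where
  "lattice_kernel x s = bernoulli_kernel x (2 * of_real pi * \<i> * s)"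

lemma exp_2pi_eq_1_iff: "exp (2 * of_real pi * \<i> * s) = 1 \<longleftrightarrow> s \<in> \<int>"
proof
  assume "exp (2 * of_real pi * \<i> * s) = 1"
  then obtain n :: int where n: "Re (2 * of_real pi * \<i> * s) = 0"
    "Im (2 * of_real pi * \<i> * s) = of_int (2 * n) * pi"
    by (subst (asm) exp_eq_1) blast
  hence "s = of_int n" by (simp add: complex_eq_iff)
  thus "s \<in> \<int>" by simp
next
  assume "s \<in> \<int>"
  then obtain n :: int where "s = of_int n" by (elim Ints_cases)
  thus "exp (2 * of_real pi * \<i> * s) = 1"
    using exp_integer_2pi[of "of_int n"] by (simp add: mult_ac)
qed

lemma lattice_kernel_eq:
  "s \<noteq> 0 \<Longrightarrow> lattice_kernel x s =
     2 * of_real pi * \<i> * s * exp (2 * of_real pi * \<i> * x * s) / (exp (2 * of_real pi * \<i> * s) - 1)"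
  by (simp add: lattice_kernel_def bernoulli_kernel_def mult_ac)

text \<open>Used in the residue computation, where the cofactor of a simple pole has to be
  nonzero.\<close>

lemma lattice_kernel_nonzero: "s \<notin> \<int> \<Longrightarrow> lattice_kernel x s \<noteq> 0"
  using exp_2pi_eq_1_iff[of s] by (subst lattice_kernel_eq) auto

text \<open>The rescaling multiplies distances by 2 pi and turns |Im s| into |Re t| / (2 pi). As 2
  pi >= 1, the same \<delta> and the same decay rate can be kept, at the price of a weaker
  estimate.\<close>

lemma lattice_kernel_decay:
  fixes x \<delta> :: real
  assumes "0 < x" "x < 1" "\<delta> > 0"
  shows "\<exists>C>0. \<forall>s::complex. (\<forall>n::int. \<delta> \<le> norm (s - n)) \<longrightarrow>
           norm (lattice_kernel x s) \<le> C * norm s * exp (- (min x (1 - x) * \<bar>Im s\<bar>))"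
proof -
  from bernoulli_kernel_decay[OF assms] obtain C where C: "C > 0"
    "\<And>t. \<forall>n::int. \<delta> \<le> norm (t - 2 * pi * \<i> * n) \<Longrightarrow>
           norm (bernoulli_kernel x t) \<le> C * norm t * exp (- (min x (1 - x) * \<bar>Re t\<bar>))"
    by blast
  have pi: "1 \<le> 2 * pi" using pi_gt3 by linarith
  have "norm (lattice_kernel x s) \<le> C * (2 * pi) * norm s * exp (- (min x (1 - x) * \<bar>Im s\<bar>))"
    if s: "\<forall>n::int. \<delta> \<le> norm (s - n)" for s :: complex
  proof -
    let ?t = "2 * of_real pi * \<i> * s"
    have "\<delta> \<le> norm (?t - 2 * pi * \<i> * n)" for n :: int
    proof -
      have "\<delta> \<le> 1 * norm (s - n)" using s by simp
      also have "\<dots> \<le> (2 * pi) * norm (s - n)" by (intro mult_right_mono pi) auto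
      also have "\<dots> = norm (2 * pi * \<i> * (s - n))" by (simp add: norm_mult)
      finally show ?thesis by (simp add: algebra_simps)
    qed
    hence "norm (lattice_kernel x s) \<le> C * norm ?t * exp (- (min x (1 - x) * \<bar>Re ?t\<bar>))"
      unfolding lattice_kernel_def by (intro C) auto
    also have "\<dots> \<le> C * norm ?t * exp (- (min x (1 - x) * \<bar>Im s\<bar>))"
    proof -
      have "1 * \<bar>Im s\<bar> \<le> (2 * pi) * \<bar>Im s\<bar>" by (intro mult_right_mono pi) auto
      hence "\<bar>Im s\<bar> \<le> \<bar>Re ?t\<bar>" by (simp add: abs_mult)
      hence "min x (1 - x) * \<bar>Im s\<bar> \<le> min x (1 - x) * \<bar>Re ?t\<bar>"
        using assms by (intro mult_left_mono) auto
      thus ?thesis using C(1) by (intro mult_left_mono) auto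
    qed
    finally show ?thesis by (simp add: norm_mult mult_ac)
  qed
  thus ?thesis using C(1) by (intro exI[of _ "C * (2 * pi)"]) auto
qed

lemma lattice_kernel_holomorphic: "lattice_kernel x holomorphic_on - (\<int> - {0})"
proof -
  have "bernoulli_kernel x \<circ> (\<lambda>s. 2 * of_real pi * \<i> * s) holomorphic_on - (\<int> - {0})"
    by (rule holomorphic_on_compose_gen[OF _ bernoulli_kernel_holomorphic])
       (auto intro!: holomorphic_intros)
  thus ?thesis by (simp add: lattice_kernel_def [abs_def] o_def)
qed

lemma lattice_kernel_analytic_at: "s \<notin> \<int> - {0} \<Longrightarrow> lattice_kernel x analytic_on {s}"
proof -
  have "closed (\<int> - {0} :: complex set)"
    by (rule closed_subset_Ints) auto
  hence "open (- (\<int> - {0} :: complex set))" by (rule open_Compl)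
  thus "s \<notin> \<int> - {0} \<Longrightarrow> ?thesis"
    using lattice_kernel_holomorphic analytic_at by blast
qed

lemma has_fps_expansion_lattice_kernel:
  "(\<lambda>w. lattice_kernel x (w / p)) has_fps_expansion
     Abs_fps (\<lambda>n. (2 * of_real pi * \<i> / p) ^ n * Bernoulli_poly n x / fact n)"
proof -
  let ?c = "2 * of_real pi * \<i> / p"
  have "(bernoulli_kernel x \<circ> (\<lambda>w. ?c * w)) has_fps_expansion
          fps_compose (Abs_fps (\<lambda>n. Bernoulli_poly n x / fact n)) (fps_const ?c * fps_X)"
    by (intro has_fps_expansion_compose has_fps_expansion_bernoulli_kernel fps_expansion_intros) simp
  also have "bernoulli_kernel x \<circ> (\<lambda>w. ?c * w) = (\<lambda>w. lattice_kernel x (w / p))"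
    by (simp add: lattice_kernel_def fun_eq_iff)
  also have "fps_compose (Abs_fps (\<lambda>n. Bernoulli_poly n x / fact n)) (fps_const ?c * fps_X) =
               Abs_fps (\<lambda>n. ?c ^ n * Bernoulli_poly n x / fact n)"
    by (rule fps_ext) (subst fps_nth_compose_linear, simp)
  finally show ?thesis .
qed

text \<open>At n p the kernel has the form f / h with h = exp (2 pi i w / p) - 1 having a simple
  zero. Its derivative 2 pi i / p cancels the factor 2 pi i in the numerator and leaves n p.\<close>

lemma residue_lattice_kernel:
  fixes n :: int and p x :: complex
  assumes "p \<noteq> 0" "n \<noteq> 0" "g analytic_on {n * p}" "g (n * p) \<noteq> 0"
  shows "residue (\<lambda>w. lattice_kernel x (w / p) * g w) (n * p) =
           exp (2 * of_real pi * \<i> * x * n) * (n * p) * g (n * p)"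
proof -
  let ?c = "2 * of_real pi * \<i> :: complex"
  define f where "f = (\<lambda>w. ?c * (w / p) * exp (?c * x * (w / p)) * g w)"
  define h where "h = (\<lambda>w. exp (?c * (w / p)) - 1)"
  have "f analytic_on {n * p}" "h analytic_on {n * p}"
    unfolding f_def h_def using assms by (auto intro!: analytic_intros)
  then obtain e1 e2 where e: "e1 > 0" "e2 > 0"
    "f holomorphic_on ball (n * p) e1" "h holomorphic_on ball (n * p) e2"
    unfolding analytic_on_def by blast
  have "exp (?c * of_int n) = 1" by (subst exp_2pi_eq_1_iff) auto
  hence exp1: "exp (2 * (of_real pi * (\<i> * of_int n))) = 1" by (simp only: mult.assoc)
  have "residue (\<lambda>w. f w / h w) (n * p) = f (n * p) / (?c / p)"
  proof (rule residue_simple_pole_deriv)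
    show "f holomorphic_on ball (n * p) (min e1 e2)" "h holomorphic_on ball (n * p) (min e1 e2)"
      by (rule holomorphic_on_subset[OF e(3)] holomorphic_on_subset[OF e(4)], force)+
    show "(h has_field_derivative ?c / p) (at (n * p))"
      unfolding h_def using assms exp1 by (auto intro!: derivative_eq_intros)
  qed (use assms e exp1 in \<open>auto simp: f_def h_def\<close>)
  also have "f (n * p) / (?c / p) = exp (?c * x * n) * (n * p) * g (n * p)"
    using assms by (simp add: f_def mult_ac)
  also have "residue (\<lambda>w. f w / h w) (n * p) = residue (\<lambda>w. lattice_kernel x (w / p) * g w) (n * p)"
  proof (rule residue_cong)
    have "eventually (\<lambda>w. w \<noteq> 0) (at (of_int n * p))"
      using assms by (intro eventually_neq_at_within)
    thus "eventually (\<lambda>w. f w / h w = lattice_kernel x (w / p) * g w) (at (n * p))"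
      by eventually_elim (use assms in \<open>simp add: lattice_kernel_eq f_def h_def\<close>)
  qed auto
  finally show ?thesis .
qed

section \<open>Summability of the residues\<close>

lemma summable_on_exp_minus_abs_int:
  assumes "c > (0::real)"
  shows "(\<lambda>n::int. exp (- (c * \<bar>real_of_int n\<bar>))) summable_on A"
proof -
  have "summable (\<lambda>n. exp (-c) ^ n)" using assms by (intro summable_geometric) auto
  hence "(\<lambda>n::nat. exp (-c) ^ n) summable_on UNIV"
    by (intro norm_summable_imp_summable_on) simp
  hence s: "(\<lambda>n::nat. exp (- (c * n))) summable_on UNIV"
    by (simp flip: exp_of_nat_mult add: mult_ac)
  have "(\<lambda>n::int. exp (- (c * \<bar>real_of_int n\<bar>))) summable_on range int"
    using s by (subst summable_on_reindex) (auto simp: o_def inj_on_def)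
  moreover have "(\<lambda>n::int. exp (- (c * \<bar>real_of_int n\<bar>))) summable_on range (\<lambda>n. - int n)"
    using s by (subst summable_on_reindex) (auto simp: o_def inj_on_def)
  ultimately have "(\<lambda>n::int. exp (- (c * \<bar>real_of_int n\<bar>))) summable_on (range int \<union> range (\<lambda>n. - int n))"
    by (rule summable_on_union)
  thus ?thesis
    by (rule summable_on_subset) (auto, metis int_cases2 rangeI)
qed

text \<open>For n different from 0 and p / r not real, this is the residue at n p of the product of
  the kernels at w / p and w / r, divided by \<open>w ^ Suc a\<close>. The factor n p from the
  residue of the first kernel lowers the exponent to \<open>a\<close>. Keeping both periods p and r
  as parameters lets the second family of poles be handled by swapping them.\<close>

definition lattice_residue :: "nat \<Rightarrow> real \<Rightarrow> real \<Rightarrow> complex \<Rightarrow> complex \<Rightarrow> int \<Rightarrow> complex" where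
  "lattice_residue a \<alpha> \<beta> p r n =
     exp (2 * of_real pi * \<i> * \<alpha> * n) * lattice_kernel \<beta> (n * p / r) / (n * p) ^ a"

lemma of_int_mult_notin_Ints:
  fixes n :: int and s :: complex
  assumes "n \<noteq> 0" "Im s \<noteq> 0"
  shows "n * s \<notin> \<int>"
  using assms by (auto elim!: Ints_cases simp: complex_eq_iff)

text \<open>The points n p / r move away from the real axis linearly in |n|, so the kernel there
  decays exponentially. The linear factor |n| in its bound is absorbed by |n| ^ a.\<close>

lemma summable_on_lattice_residue:
  fixes \<alpha> \<beta> :: real and p r :: complex
  assumes "a \<ge> 1" "0 < \<beta>" "\<beta> < 1" "Im (p / r) \<noteq> 0"
  shows "lattice_residue a \<alpha> \<beta> p r summable_on (UNIV - {0})"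
proof (rule abs_summable_summable)
  define \<theta> where "\<theta> = p / r"
  define c where "c = min \<beta> (1 - \<beta>)"
  have \<theta>: "\<bar>Im \<theta>\<bar> > 0" and "c > 0" "p \<noteq> 0" using assms by (auto simp: \<theta>_def c_def)
  \<comment> \<open>|Im \<theta>| can serve as the distance to the integers, because n \<theta> has
    an imaginary part at least that large for every nonzero n.\<close>
  from lattice_kernel_decay[OF assms(2,3) \<theta>] obtain C where C: "C > 0"
    "\<And>s::complex. \<forall>n::int. \<bar>Im \<theta>\<bar> \<le> norm (s - n) \<Longrightarrow>
         norm (lattice_kernel \<beta> s) \<le> C * norm s * exp (- (c * \<bar>Im s\<bar>))"
    unfolding c_def by blast
  define D where "D = C * norm \<theta> / norm p ^ a"
  show "(\<lambda>n. norm (lattice_residue a \<alpha> \<beta> p r n)) summable_on (UNIV - {0})"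
  proof (rule summable_on_comparison_test)
    show "(\<lambda>n::int. D * exp (- ((c * \<bar>Im \<theta>\<bar>) * \<bar>real_of_int n\<bar>))) summable_on (UNIV - {0})"
      using \<theta> \<open>c > 0\<close> by (intro summable_on_cmult_right summable_on_exp_minus_abs_int) auto
  next
    fix n :: int assume "n \<in> UNIV - {0}"
    hence n: "1 \<le> \<bar>real_of_int n\<bar>" by auto
    have "\<bar>Im \<theta>\<bar> \<le> norm (n * \<theta> - m)" for m :: int
    proof -
      have "1 * \<bar>Im \<theta>\<bar> \<le> \<bar>real_of_int n\<bar> * \<bar>Im \<theta>\<bar>" by (intro mult_right_mono n) auto
      also have "\<dots> = \<bar>Im (n * \<theta> - m)\<bar>" by (simp add: abs_mult)
      also have "\<dots> \<le> norm (n * \<theta> - m)" by (rule abs_Im_le_cmod)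
      finally show ?thesis by simp
    qed
    hence le: "norm (lattice_kernel \<beta> (n * \<theta>)) \<le> C * norm (n * \<theta>) * exp (- (c * \<bar>Im (n * \<theta>)\<bar>))"
      by (intro C) auto
    have "norm (lattice_residue a \<alpha> \<beta> p r n) = norm (lattice_kernel \<beta> (n * \<theta>)) / norm (n * p) ^ a"
      by (simp add: lattice_residue_def norm_mult norm_divide norm_power \<theta>_def)
    also have "\<dots> \<le> C * norm (n * \<theta>) * exp (- (c * \<bar>Im (n * \<theta>)\<bar>)) / norm (n * p) ^ a"
      by (intro divide_right_mono le) auto
    also have "\<dots> = \<bar>real_of_int n\<bar> / \<bar>real_of_int n\<bar> ^ a * (D * exp (- ((c * \<bar>Im \<theta>\<bar>) * \<bar>real_of_int n\<bar>)))"
      by (simp add: D_def norm_mult abs_mult power_mult_distrib mult_ac)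
    also have "\<dots> \<le> 1 * (D * exp (- ((c * \<bar>Im \<theta>\<bar>) * \<bar>real_of_int n\<bar>)))"
    proof (rule mult_right_mono)
      have "\<bar>real_of_int n\<bar> ^ 1 \<le> \<bar>real_of_int n\<bar> ^ a"
        using n assms by (intro power_increasing) auto
      thus "\<bar>real_of_int n\<bar> / \<bar>real_of_int n\<bar> ^ a \<le> 1" using n assms(1) by (simp add: divide_le_eq_1)
    qed (use C(1) in \<open>simp add: D_def\<close>)
    finally show "norm (lattice_residue a \<alpha> \<beta> p r n) \<le> D * exp (- ((c * \<bar>Im \<theta>\<bar>) * \<bar>real_of_int n\<bar>))"
      by simp
  qed auto
qed

section \<open>Decay of the product of the two kernels\<close>

text \<open>For non-real \<theta> the two imaginary parts determine s linearly: Re s * Im \<theta> =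
  Im (s \<theta>) - Im s * Re \<theta>. This makes precise that s and s \<theta> cannot both be
  nearly real.\<close>

lemma norm_le_Im_plus_Im:
  assumes "Im \<theta> \<noteq> 0"
  shows "\<exists>k>0. \<forall>s. k * norm s \<le> \<bar>Im s\<bar> + \<bar>Im (s * \<theta>)\<bar>"
proof -
  define m where "m = 1 + \<bar>Re \<theta>\<bar> + \<bar>Im \<theta>\<bar>"
  have "m > 0" by (simp add: m_def)
  have "\<bar>Im \<theta>\<bar> / m * norm s \<le> \<bar>Im s\<bar> + \<bar>Im (s * \<theta>)\<bar>" for s
  proof -
    have "\<bar>Im \<theta>\<bar> * norm s \<le> \<bar>Im \<theta>\<bar> * (\<bar>Re s\<bar> + \<bar>Im s\<bar>)"
      by (intro mult_left_mono cmod_le) auto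
    also have "\<bar>Im \<theta>\<bar> * \<bar>Re s\<bar> = \<bar>Im (s * \<theta>) - Im s * Re \<theta>\<bar>"
      by (simp add: abs_mult mult_ac)
    hence "\<bar>Im \<theta>\<bar> * (\<bar>Re s\<bar> + \<bar>Im s\<bar>) \<le> \<bar>Im (s * \<theta>)\<bar> + \<bar>Im s\<bar> * \<bar>Re \<theta>\<bar> + \<bar>Im s\<bar> * \<bar>Im \<theta>\<bar>"
      using abs_triangle_ineq4[of "Im (s * \<theta>)" "Im s * Re \<theta>"]
      by (simp add: distrib_left abs_mult[of "Im s" "Re \<theta>"] mult_ac)
    also have "\<dots> \<le> m * (\<bar>Im s\<bar> + \<bar>Im (s * \<theta>)\<bar>)"
      by (simp add: m_def algebra_simps)
    finally show ?thesis using \<open>m > 0\<close> by (simp add: field_simps)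
  qed
  thus ?thesis using assms \<open>m > 0\<close> by (intro exI[of _ "\<bar>Im \<theta>\<bar> / m"]) auto
qed

text \<open>The two decay estimates multiply, and \<open>norm_le_Im_plus_Im\<close> with s = w / p
  and \<theta> = p / r turns the sum of imaginary parts into a multiple of |w|. The hypothesis
  speaks only of |w|, so it holds on a whole circle at once.\<close>

lemma lattice_kernel_product_decay:
  fixes \<alpha> \<beta> \<delta> :: real and p r :: complex
  assumes "0 < \<alpha>" "\<alpha> < 1" "0 < \<beta>" "\<beta> < 1" "Im (p / r) \<noteq> 0" "\<delta> > 0"
  shows "\<exists>C>0. \<exists>c>0. \<forall>w::complex.
           (\<forall>n::int. \<delta> \<le> \<bar>norm w - n * norm p\<bar> \<and> \<delta> \<le> \<bar>norm w - n * norm r\<bar>) \<longrightarrow>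
           norm (lattice_kernel \<alpha> (w / p) * lattice_kernel \<beta> (w / r)) \<le>
             C * norm w ^ 2 * exp (- (c * norm w))"
proof -
  have nz: "p \<noteq> 0" "r \<noteq> 0" using assms by auto
  \<comment> \<open>The gap \<delta> measured in the coordinates w / p and w / r, where the poles
    become integers.\<close>
  define e where "e = min (\<delta> / norm p) (\<delta> / norm r)"
  have e: "e > 0" "e * norm p \<le> \<delta>" "e * norm r \<le> \<delta>"
    using nz assms by (auto simp: e_def min_def field_simps)
  define c where "c = min (min \<alpha> (1 - \<alpha>)) (min \<beta> (1 - \<beta>))"
  have c: "c > 0" using assms by (auto simp: c_def)
  from lattice_kernel_decay[OF assms(1,2) e(1)] obtain C1 where C1: "C1 > 0"
    "\<And>s::complex. \<forall>n::int. e \<le> norm (s - n) \<Longrightarrow>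
       norm (lattice_kernel \<alpha> s) \<le> C1 * norm s * exp (- (min \<alpha> (1 - \<alpha>) * \<bar>Im s\<bar>))" by blast
  from lattice_kernel_decay[OF assms(3,4) e(1)] obtain C2 where C2: "C2 > 0"
    "\<And>s::complex. \<forall>n::int. e \<le> norm (s - n) \<Longrightarrow>
       norm (lattice_kernel \<beta> s) \<le> C2 * norm s * exp (- (min \<beta> (1 - \<beta>) * \<bar>Im s\<bar>))" by blast
  from norm_le_Im_plus_Im[OF assms(5)] obtain k where k: "k > 0"
    "\<And>s::complex. k * norm s \<le> \<bar>Im s\<bar> + \<bar>Im (s * (p / r))\<bar>" by blast
  have far: "\<forall>n::int. e \<le> norm (w / b - n)"
    if "\<forall>n::int. \<delta> \<le> \<bar>norm w - n * norm b\<bar>" "b \<noteq> 0" "e * norm b \<le> \<delta>" for w b :: complex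
  proof
    fix n :: int
    have "e * norm b \<le> \<bar>norm w - \<bar>n\<bar> * norm b\<bar>" using that(1,3) order_trans by blast
    also have "\<dots> = \<bar>norm w - norm (n * b)\<bar>" by (simp add: norm_mult)
    also have "\<dots> \<le> norm (w - n * b)" by (rule norm_triangle_ineq3)
    also have "\<dots> = norm ((w / b - n) * b)" using that(2) by (simp add: left_diff_distrib)
    also have "\<dots> = norm (w / b - n) * norm b" by (rule norm_mult)
    finally show "e \<le> norm (w / b - n)" using that(2) by simp
  qed
  show ?thesis
  proof (intro exI conjI allI impI)
    fix w :: complex
    assume w: "\<forall>n::int. \<delta> \<le> \<bar>norm w - n * norm p\<bar> \<and> \<delta> \<le> \<bar>norm w - n * norm r\<bar>"
    have le1: "norm (lattice_kernel \<alpha> (w / p)) \<le> C1 * norm (w / p) * exp (- (c * \<bar>Im (w / p)\<bar>))"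
    proof -
      have "norm (lattice_kernel \<alpha> (w / p)) \<le> C1 * norm (w / p) * exp (- (min \<alpha> (1 - \<alpha>) * \<bar>Im (w / p)\<bar>))"
        using w nz e by (intro C1 far) auto
      also have "\<dots> \<le> C1 * norm (w / p) * exp (- (c * \<bar>Im (w / p)\<bar>))"
        using C1(1) by (intro mult_left_mono) (auto simp: c_def intro!: mult_right_mono)
      finally show ?thesis .
    qed
    have le2: "norm (lattice_kernel \<beta> (w / r)) \<le> C2 * norm (w / r) * exp (- (c * \<bar>Im (w / r)\<bar>))"
    proof -
      have "norm (lattice_kernel \<beta> (w / r)) \<le> C2 * norm (w / r) * exp (- (min \<beta> (1 - \<beta>) * \<bar>Im (w / r)\<bar>))"
        using w nz e by (intro C2 far) auto
      also have "\<dots> \<le> C2 * norm (w / r) * exp (- (c * \<bar>Im (w / r)\<bar>))"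
        using C2(1) by (intro mult_left_mono) (auto simp: c_def intro!: mult_right_mono)
      finally show ?thesis .
    qed
    have "norm (lattice_kernel \<alpha> (w / p) * lattice_kernel \<beta> (w / r)) \<le>
            (C1 * norm (w / p) * exp (- (c * \<bar>Im (w / p)\<bar>))) * (C2 * norm (w / r) * exp (- (c * \<bar>Im (w / r)\<bar>)))"
      unfolding norm_mult using C1(1) by (intro mult_mono le1 le2) auto
    also have "\<dots> = (C1 * C2 / (norm p * norm r)) * norm w ^ 2 *
                     exp (- (c * (\<bar>Im (w / p)\<bar> + \<bar>Im (w / r)\<bar>)))"
    proof -
      have "exp (- (c * (\<bar>Im (w / p)\<bar> + \<bar>Im (w / r)\<bar>))) =
              exp (- (c * \<bar>Im (w / p)\<bar>)) * exp (- (c * \<bar>Im (w / r)\<bar>))"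
        by (simp only: distrib_left minus_add_distrib exp_add)
      thus ?thesis by (simp only: norm_divide) (simp add: power2_eq_square)
    qed
    also have "\<dots> \<le> (C1 * C2 / (norm p * norm r)) * norm w ^ 2 * exp (- (c * k / norm p * norm w))"
    proof -
      have "k * norm (w / p) \<le> \<bar>Im (w / p)\<bar> + \<bar>Im (w / r)\<bar>"
        using k(2)[of "w / p"] nz by simp
      hence "c * (k * norm (w / p)) \<le> c * (\<bar>Im (w / p)\<bar> + \<bar>Im (w / r)\<bar>)"
        using c by (intro mult_left_mono) auto
      thus ?thesis using C1(1) C2(1) by (intro mult_left_mono) (auto simp: norm_divide)
    qed
    finally show "norm (lattice_kernel \<alpha> (w / p) * lattice_kernel \<beta> (w / r)) \<le>
      (C1 * C2 / (norm p * norm r)) * norm w ^ 2 * exp (- (c * k / norm p * norm w))" .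
  qed (use nz C1(1) C2(1) c k(1) in auto)
qed

section \<open>Residue sums over discs\<close>

definition nonzero_ints_below :: "real \<Rightarrow> int set" where
  "nonzero_ints_below R = {n. n \<noteq> 0 \<and> \<bar>real_of_int n\<bar> < R}"

lemma finite_nonzero_ints_below [simp]: "finite (nonzero_ints_below R)"
proof (rule finite_subset)
  show "nonzero_ints_below R \<subseteq> {-\<lceil>R\<rceil>..\<lceil>R\<rceil>}"
    unfolding nonzero_ints_below_def by (auto simp: abs_less_iff) linarith+
qed auto

text \<open>Every finite set of nonzero integers is eventually covered, so the truncations given by
  the circles compute the unordered infinite sums.\<close>

lemma filterlim_nonzero_ints_below:
  "filterlim nonzero_ints_below (finite_subsets_at_top (UNIV - {0})) at_top"
  unfolding filterlim_finite_subsets_at_top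
proof (intro allI impI)
  fix X :: "int set" assume X: "finite X \<and> X \<subseteq> UNIV - {0}"
  hence "\<forall>n\<in>X. eventually (\<lambda>R. \<bar>real_of_int n\<bar> < R) at_top"
    by (simp add: eventually_gt_at_top)
  hence "eventually (\<lambda>R. \<forall>n\<in>X. \<bar>real_of_int n\<bar> < R) at_top"
    using X by (simp add: eventually_ball_finite_distrib)
  thus "eventually (\<lambda>R. finite (nonzero_ints_below R) \<and> X \<subseteq> nonzero_ints_below R \<and>
          nonzero_ints_below R \<subseteq> UNIV - {0}) at_top"
  proof eventually_elim
    case (elim R)
    thus ?case using X finite_nonzero_ints_below[of R] unfolding nonzero_ints_below_def by blast
  qed
qed

lemma nonzero_multiples_eq:
  fixes p :: complex
  assumes "p \<noteq> 0"
  shows "(\<lambda>n::int. of_int n * p) ` nonzero_ints_below (R / norm p) = {w. norm w < R \<and> w / p \<in> \<int> - {0}}"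
proof (intro equalityI subsetI)
  fix w assume "w \<in> {w. norm w < R \<and> w / p \<in> \<int> - {0}}"
  then obtain n :: int where n: "w = n * p" "n \<noteq> 0" "norm w < R"
    using assms by (auto elim!: Ints_cases simp: field_simps)
  thus "w \<in> (\<lambda>n::int. n * p) ` nonzero_ints_below (R / norm p)"
    using assms by (auto simp: nonzero_ints_below_def norm_mult field_simps)
qed (use assms in \<open>auto simp: nonzero_ints_below_def norm_mult field_simps\<close>)

lemma Im_divide_swap_nonzero: "Im (p / r) \<noteq> 0 \<Longrightarrow> Im (r / p) \<noteq> 0"
  by (auto simp: Im_divide complex_eq_iff field_simps)

text \<open>At n p the argument n p / r of the second kernel is not real, so that kernel is analytic
  and nonzero there and belongs to the cofactor of the simple pole.\<close>

lemma residue_lattice_kernel_product: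
  fixes n :: int and p r :: complex
  assumes "Im (p / r) \<noteq> 0" "n \<noteq> 0"
  shows "residue (\<lambda>w. lattice_kernel \<alpha> (w / p) * lattice_kernel \<beta> (w / r) / w ^ Suc a) (n * p) =
           lattice_residue a \<alpha> \<beta> p r n"
proof -
  have nz: "p \<noteq> 0" "r \<noteq> 0" using assms by auto
  define g where "g = (\<lambda>w. lattice_kernel \<beta> (w / r) / w ^ Suc a)"
  have notin: "n * p / r \<notin> \<int>"
    using of_int_mult_notin_Ints[OF assms(2,1)] by simp
  have "lattice_kernel \<beta> \<circ> (\<lambda>w. w / r) analytic_on {n * p}"
    using notin nz
    by (intro analytic_on_compose_gen[where T = "{n * p / r}"] analytic_intros lattice_kernel_analytic_at) auto
  hence "g analytic_on {n * p}"
    unfolding g_def using assms nz by (intro analytic_intros) (auto simp: o_def)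
  moreover have "g (n * p) \<noteq> 0"
    using lattice_kernel_nonzero[OF notin] assms nz by (simp add: g_def)
  ultimately have "residue (\<lambda>w. lattice_kernel \<alpha> (w / p) * g w) (n * p) =
      exp (2 * of_real pi * \<i> * \<alpha> * n) * (n * p) * g (n * p)"
    using residue_lattice_kernel nz assms by blast
  thus ?thesis using assms nz by (simp add: g_def lattice_residue_def)
qed

text \<open>The left side is the sum of all residues of \<open>G w / w ^ Suc a\<close> in the disc
  of radius R: the one at 0 is the Cauchy product of the two Bernoulli expansions, and the other two
  sums come from the multiples of p and of r. By the residue theorem it is a contour integral,
  bounded by the maximum on the circle.\<close>

lemma lattice_residue_partial_sums_bound:
  fixes \<alpha> \<beta> R \<delta> B :: real and p r :: complex
  defines "G \<equiv> (\<lambda>w::complex. lattice_kernel \<alpha> (w / p) * lattice_kernel \<beta> (w / r))"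
  assumes im: "Im (p / r) \<noteq> 0" and "R > 0" "\<delta> > 0"
    and far: "\<And>n::int. \<delta> \<le> \<bar>R - n * norm p\<bar>" "\<And>n::int. \<delta> \<le> \<bar>R - n * norm r\<bar>"
    and B: "B \<ge> 0" "\<And>w::complex. norm w = R \<Longrightarrow> norm (G w) \<le> B"
  shows "norm ((\<Sum>n=0..a. (2 * of_real pi * \<i> / r) ^ n * Bernoulli_poly n (of_real \<beta>) / fact n *
                 ((2 * of_real pi * \<i> / p) ^ (a - n) * Bernoulli_poly (a - n) (of_real \<alpha>) / fact (a - n)))
            + ((\<Sum>n\<in>nonzero_ints_below (R / norm p). lattice_residue a \<alpha> \<beta> p r n)
             + (\<Sum>n\<in>nonzero_ints_below (R / norm r). lattice_residue a \<beta> \<alpha> r p n))) \<le> B / R ^ a"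
proof -
  have nz: "p \<noteq> 0" "r \<noteq> 0" using im by auto
  have G_commute: "G = (\<lambda>w. lattice_kernel \<beta> (w / r) * lattice_kernel \<alpha> (w / p))"
    by (simp add: G_def mult.commute)
  define S where "S = (\<lambda>b::complex. (\<lambda>n::int. n * b) ` nonzero_ints_below (R / norm b))"
  have S: "S b = {w. norm w < R \<and> w / b \<in> \<int> - {0}}" if "b \<noteq> 0" for b
    unfolding S_def using nonzero_multiples_eq[OF that] .
  \<comment> \<open>The gap \<delta> excludes poles of norm between R and R + \<delta>. Thus the
    poles inside the circle are the only ones in a larger open disc, as the residue theorem
    requires.\<close>
  have S_outer: "w / b \<notin> \<int> - {0}"
    if wb: "norm w < R + \<delta>" "w \<notin> S b" "b \<noteq> 0" "\<And>n::int. \<delta> \<le> \<bar>R - n * norm b\<bar>" for w b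
  proof
    assume *: "w / b \<in> \<int> - {0}"
    then obtain n :: int where "w = n * b"
      using wb(3) by (auto elim!: Ints_cases simp: field_simps)
    hence "norm w = \<bar>n\<bar> * norm b" by (simp add: norm_mult)
    with wb(4)[of "\<bar>n\<bar>"] wb(1) \<open>\<delta> > 0\<close> have "norm w < R" by linarith
    with * S[OF wb(3)] wb(2) show False by simp
  qed
  define P :: "complex \<Rightarrow> complex \<Rightarrow> complex fps"
    where "P = (\<lambda>x b. Abs_fps (\<lambda>n. (2 * of_real pi * \<i> / b) ^ n * Bernoulli_poly n x / fact n))"
  have G: "G has_fps_expansion P (of_real \<beta>) r * P (of_real \<alpha>) p"
    unfolding G_commute P_def by (intro has_fps_expansion_mult has_fps_expansion_lattice_kernel)
  have "G analytic_on {w}" if w: "w \<in> ball 0 (R + \<delta>) - (S p \<union> S r)" for w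
  proof -
    have "lattice_kernel x \<circ> (\<lambda>w. w / b) analytic_on {w}" if "w / b \<notin> \<int> - {0}" "b \<noteq> 0" for x b
      using that by (intro analytic_on_compose_gen[where T = "{w / b}"] analytic_intros
          lattice_kernel_analytic_at) auto
    moreover have w': "norm w < R + \<delta>" "w \<notin> S p" "w \<notin> S r" using w by auto
    have "w / p \<notin> \<int> - {0}" "w / r \<notin> \<int> - {0}"
      using S_outer[OF w'(1,2) nz(1) far(1)] S_outer[OF w'(1,3) nz(2) far(2)] by blast+
    ultimately show ?thesis unfolding G_def o_def using nz by (intro analytic_intros) auto
  qed
  hence holo: "G holomorphic_on ball 0 (R + \<delta>) - (S p \<union> S r)"
    using analytic_on_analytic_at analytic_imp_holomorphic by blast
  have "norm ((deriv ^^ a) G 0 / fact a + (\<Sum>z\<in>S p \<union> S r. residue (\<lambda>w. G w / w ^ Suc a) z)) \<le> B / R ^ a"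
  proof (rule fps_coeff_residues_bound[where A = "ball 0 (R + \<delta>)" and k = "{}"])
    show "S p \<union> S r \<subseteq> ball 0 R" "0 \<notin> S p \<union> S r" using S nz by auto
    show "finite (S p \<union> S r)" by (simp add: S_def)
  qed (use holo B \<open>R > 0\<close> \<open>\<delta> > 0\<close> in auto)
  also have "(deriv ^^ a) G 0 / fact a = fps_nth (P (of_real \<beta>) r * P (of_real \<alpha>) p) a"
    using fps_nth_fps_expansion[OF G] by simp
  also have "(\<Sum>z\<in>S p \<union> S r. residue (\<lambda>w. G w / w ^ Suc a) z) =
      (\<Sum>z\<in>S p. residue (\<lambda>w. G w / w ^ Suc a) z) + (\<Sum>z\<in>S r. residue (\<lambda>w. G w / w ^ Suc a) z)"
  proof (rule sum.union_disjoint)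
    \<comment> \<open>A common point m p = n r would make m (p / r) an integer, although p / r is
      not real.\<close>
    show "S p \<inter> S r = {}"
    proof safe
      fix w assume "w \<in> S p" "w \<in> S r"
      then obtain m n :: int where mn: "w = m * p" "w = n * r" "m \<noteq> 0"
        unfolding S_def nonzero_ints_below_def by blast
      hence "m * (p / r) = n" using nz by (simp add: field_simps)
      thus "w \<in> {}" using of_int_mult_notin_Ints[OF \<open>m \<noteq> 0\<close> im] by simp
    qed
  qed (simp_all add: S_def)
  also have "(\<Sum>z\<in>S p. residue (\<lambda>w. G w / w ^ Suc a) z) =
      (\<Sum>n\<in>nonzero_ints_below (R / norm p). residue (\<lambda>w. G w / w ^ Suc a) (n * p))"
    unfolding S_def by (rule sum.reindex_cong[OF _ refl refl]) (use nz in \<open>auto simp: inj_on_def\<close>)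
  also have "\<dots> = (\<Sum>n\<in>nonzero_ints_below (R / norm p). lattice_residue a \<alpha> \<beta> p r n)"
    unfolding G_def
    by (intro sum.cong refl residue_lattice_kernel_product im) (auto simp: nonzero_ints_below_def)
  also have "(\<Sum>z\<in>S r. residue (\<lambda>w. G w / w ^ Suc a) z) =
      (\<Sum>n\<in>nonzero_ints_below (R / norm r). residue (\<lambda>w. G w / w ^ Suc a) (n * r))"
    unfolding S_def by (rule sum.reindex_cong[OF _ refl refl]) (use nz in \<open>auto simp: inj_on_def\<close>)
  also have "\<dots> = (\<Sum>n\<in>nonzero_ints_below (R / norm r). lattice_residue a \<beta> \<alpha> r p n)"
    unfolding G_commute
    by (intro sum.cong refl residue_lattice_kernel_product Im_divide_swap_nonzero[OF im])
       (auto simp: nonzero_ints_below_def)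
  also have "fps_nth (P (of_real \<beta>) r * P (of_real \<alpha>) p) a =
      (\<Sum>n=0..a. (2 * of_real pi * \<i> / r) ^ n * Bernoulli_poly n (of_real \<beta>) / fact n *
         ((2 * of_real pi * \<i> / p) ^ (a - n) * Bernoulli_poly (a - n) (of_real \<alpha>) / fact (a - n)))"
    by (simp add: fps_mult_nth P_def)
  finally show ?thesis .
qed

section \<open>The limit of large circles\<close>

theorem lattice_residue_sum:
  fixes \<alpha> \<beta> :: real and p r :: complex
  assumes "a \<ge> 2" "0 < \<alpha>" "\<alpha> < 1" "0 < \<beta>" "\<beta> < 1" "Im (p / r) \<noteq> 0"
  shows "(\<Sum>\<^sub>\<infinity>n\<in>UNIV - {0}. lattice_residue a \<alpha> \<beta> p r n)
       + (\<Sum>\<^sub>\<infinity>n\<in>UNIV - {0}. lattice_residue a \<beta> \<alpha> r p n) =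
       - (\<Sum>n=0..a. (2 * of_real pi * \<i> / r) ^ n * Bernoulli_poly n (of_real \<beta>) / fact n *
            ((2 * of_real pi * \<i> / p) ^ (a - n) * Bernoulli_poly (a - n) (of_real \<alpha>) / fact (a - n)))"
    (is "?A + ?B = - ?c")
proof -
  have nz: "p \<noteq> 0" "r \<noteq> 0" using assms by auto
  from radii_avoiding_multiples[of "norm p" "norm r"] nz obtain \<delta> where \<delta>: "\<delta> > 0"
    "\<And>N. \<exists>R\<ge>N. \<forall>n::int. \<delta> \<le> \<bar>R - n * norm p\<bar> \<and> \<delta> \<le> \<bar>R - n * norm r\<bar>" by auto
  \<comment> \<open>\<open>Suc N\<close> instead of N guarantees radii of at least 1, which the
    comparison of powers of \<open>R N\<close> uses.\<close>
  from \<delta>(2) have "\<forall>N::nat. \<exists>R\<ge>real (Suc N). \<forall>n::int. \<delta> \<le> \<bar>R - n * norm p\<bar> \<and> \<delta> \<le> \<bar>R - n * norm r\<bar>"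
    by blast
  then obtain R where R: "\<And>N. R N \<ge> real (Suc N)"
    "\<And>N n::int. \<delta> \<le> \<bar>R N - n * norm p\<bar>" "\<And>N n::int. \<delta> \<le> \<bar>R N - n * norm r\<bar>"
    by metis
  from lattice_kernel_product_decay[OF assms(2-6) \<delta>(1)] obtain C c where C: "C > 0" "c > 0"
    "\<And>w::complex. \<forall>n::int. \<delta> \<le> \<bar>norm w - n * norm p\<bar> \<and> \<delta> \<le> \<bar>norm w - n * norm r\<bar> \<Longrightarrow>
       norm (lattice_kernel \<alpha> (w / p) * lattice_kernel \<beta> (w / r)) \<le> C * norm w ^ 2 * exp (- (c * norm w))"
    by blast
  define E where "E = (\<lambda>N. ?c + ((\<Sum>n\<in>nonzero_ints_below (R N / norm p). lattice_residue a \<alpha> \<beta> p r n)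
             + (\<Sum>n\<in>nonzero_ints_below (R N / norm r). lattice_residue a \<beta> \<alpha> r p n)))"
  have R_top: "filterlim R at_top sequentially"
  proof (rule filterlim_at_top_mono)
    show "filterlim (\<lambda>N. real (Suc N)) at_top sequentially"
      by (rule filterlim_compose[OF filterlim_real_sequentially filterlim_Suc])
  qed (use R(1) in auto)
  have bound: "norm (E N) \<le> C * exp (- (c * R N))" for N
  proof -
    have R1: "1 \<le> R N" using R(1)[of N] by simp
    have "norm (E N) \<le> C * R N ^ 2 * exp (- (c * R N)) / R N ^ a"
      unfolding E_def
    proof (rule lattice_residue_partial_sums_bound[where \<delta> = \<delta>])
      fix w :: complex assume "norm w = R N"
      thus "norm (lattice_kernel \<alpha> (w / p) * lattice_kernel \<beta> (w / r)) \<le> C * R N ^ 2 * exp (- (c * R N))"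
        using C(3)[of w] R by simp
    qed (use assms R \<delta> C R1 in auto)
    also have "\<dots> = C * exp (- (c * R N)) * (R N ^ 2 / R N ^ a)" by simp
    \<comment> \<open>As a >= 2, the quadratic factor of the kernel bound is absorbed by
      \<open>R N ^ a\<close>.\<close>
    also have "\<dots> \<le> C * exp (- (c * R N)) * 1"
      using C R1 assms power_increasing[of 2 a "R N"]
      by (intro mult_left_mono) (auto simp: divide_le_eq_1)
    finally show ?thesis by simp
  qed
  have "(\<lambda>N. C * exp (- (c * R N))) \<longlonglongrightarrow> C * 0"
  proof (intro tendsto_mult tendsto_const)
    have "filterlim (\<lambda>N. c * R N) at_top sequentially"
      by (rule filterlim_tendsto_pos_mult_at_top[OF tendsto_const C(2) R_top])
    hence "filterlim (\<lambda>N. - (c * R N)) at_bot sequentially"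
      by (simp add: filterlim_uminus_at_bot)
    thus "(\<lambda>N. exp (- (c * R N))) \<longlonglongrightarrow> 0"
      by (rule filterlim_compose[OF exp_at_bot])
  qed
  hence "(\<lambda>N. C * exp (- (c * R N))) \<longlonglongrightarrow> 0" by simp
  hence E0: "E \<longlonglongrightarrow> 0"
    by (rule Lim_null_comparison[rotated]) (use bound in auto)
  have partial: "(\<lambda>N. sum f (nonzero_ints_below (R N / norm b))) \<longlonglongrightarrow> infsum f (UNIV - {0})"
    if "f summable_on (UNIV - {0})" "b \<noteq> 0" for f :: "int \<Rightarrow> complex" and b :: complex
  proof (rule filterlim_compose[OF infsum_tendsto[OF that(1)]])
    have "filterlim (\<lambda>N. (1 / norm b) * R N) at_top sequentially"
      by (rule filterlim_tendsto_pos_mult_at_top[OF tendsto_const _ R_top]) (use that in auto)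
    thus "filterlim (\<lambda>N. nonzero_ints_below (R N / norm b)) (finite_subsets_at_top (UNIV - {0})) sequentially"
      by (intro filterlim_compose[OF filterlim_nonzero_ints_below]) simp
  qed
  have "E \<longlonglongrightarrow> ?c + (?A + ?B)"
    unfolding E_def using assms nz
    by (intro tendsto_add tendsto_const partial summable_on_lattice_residue
        Im_divide_swap_nonzero[OF assms(6)]) auto
  hence "?c + (?A + ?B) = 0" using E0 LIMSEQ_unique by blast
  thus ?thesis by (simp add: eq_neg_iff_add_eq_0 add.commute)
qed

section \<open>Return to the Eisenstein-type series\<close>

text \<open>Expanding the fraction by exp t proves this; it is the generating-function form of the
  reflection formula for Bernoulli polynomials. It produces the 1 - \<beta> in the first
  series.\<close>

lemma lattice_kernel_minus: "lattice_kernel x (- s) = lattice_kernel (1 - x) s"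
proof (cases "s = 0")
  case False
  define t where "t = 2 * of_real pi * \<i> * s"
  have "exp t * (exp (- t) - 1) = 1 - exp t"
    by (simp add: algebra_simps flip: exp_add)
  hence "(- t * exp (- x * t)) / (exp (- t) - 1) = (exp t * (- t * exp (- x * t))) / (1 - exp t)"
    by (metis exp_not_eq_zero mult_divide_mult_cancel_left)
  also have "\<dots> = t * exp ((1 - x) * t) / (exp t - 1)"
  proof -
    have "exp ((1 - x) * t) = exp t * exp (- x * t)"
      by (simp add: left_diff_distrib flip: exp_add)
    hence num: "exp t * (- t * exp (- x * t)) = - (t * exp ((1 - x) * t))" by simp
    have den: "1 - exp t = - (exp t - 1)" by simp
    show ?thesis unfolding num den by (rule minus_divide_divide)
  qed
  finally show ?thesis
    using False by (simp add: lattice_kernel_eq t_def mult_ac)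
qed (simp add: lattice_kernel_def bernoulli_kernel_def)

text \<open>Termwise, the exponential splits into a factor for y and one for x. The factor 2 pi i n
  \<tau> of the kernel raises the power of n from a - 1 to a, and the sign comes from 1 - q^n
  against q^n - 1. Both arguments in the main identity have the shape x \<tau> + y, the second one
  relative to -1/\<tau>.\<close>

lemma calE_eq_lattice_kernel_sum:
  fixes \<tau> x y :: complex
  assumes "a \<ge> 1" "\<tau> \<noteq> 0"
  shows "- (2 * of_real pi * \<i> * \<tau>) * calE (2 - int a) (x * \<tau> + y) \<tau> =
           (\<Sum>\<^sub>\<infinity>n\<in>UNIV - {0}.
              exp (2 * of_real pi * \<i> * y * of_int n) * lattice_kernel x (of_int n * \<tau>) / of_int n ^ a)"
proof -
  let ?c = "2 * of_real pi * \<i> :: complex"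
  have "- (?c * \<tau>) * (exp (?c * (x * \<tau> + y)) powi n /
          (of_int n powi (1 - (2 - int a)) * (1 - exp (?c * \<tau>) powi n))) =
        exp (?c * y * of_int n) * lattice_kernel x (of_int n * \<tau>) / of_int n ^ a"
    if "n \<in> UNIV - {0}" for n :: int
  proof -
    have n: "n \<noteq> 0" using that by simp
    have "1 - (2 - int a) = int (a - 1)" using assms by simp
    hence pow: "(of_int n :: complex) powi (1 - (2 - int a)) = of_int n ^ (a - 1)"
      by (simp only: power_int_of_nat)
    have pow': "(of_int n :: complex) ^ a = of_int n * of_int n ^ (a - 1)"
      using assms by (cases a) auto
    have e: "exp (of_int n * (?c * (x * \<tau> + y))) = exp (?c * y * of_int n) * exp (?c * x * (of_int n * \<tau>))"
      by (simp add: algebra_simps flip: exp_add)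
    have e': "exp (of_int n * (?c * \<tau>)) = exp (?c * (of_int n * \<tau>))" by (simp add: mult_ac)
    have flip: "1 - exp (?c * (of_int n * \<tau>)) = - (exp (?c * (of_int n * \<tau>)) - 1)" by simp
    have K: "lattice_kernel x (of_int n * \<tau>) =
        ?c * (of_int n * \<tau>) * exp (?c * x * (of_int n * \<tau>)) / (exp (?c * (of_int n * \<tau>)) - 1)"
      using n assms by (intro lattice_kernel_eq) auto
    have alg: "- (?c * \<tau>) * (A * B / (N * - D)) = A * (?c * (m * \<tau>) * B / D) / (m * N)"
      if "m \<noteq> 0" for A B N D m :: complex
      using that by (simp add: mult_ac)
    show ?thesis
      unfolding exp_power_int pow pow' e e' flip K by (rule alg) (use n in simp)
  qed
  thus ?thesis
    unfolding calE_def Let_def infsum_cmult_right' [symmetric] by (intro infsum_cong)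
qed

theorem theorem1p3:
  fixes a :: nat and \<alpha> \<beta> :: real and \<tau> :: complex
  assumes "a \<ge> 2"
    and "0 < \<alpha>" and "\<alpha> < 1"
    and "0 < \<beta>" and "\<beta> < 1"
    and "Im \<tau> > 0"
  shows "calE (2 - int a) ((1 - of_real \<beta>) * \<tau> + of_real \<alpha>) \<tau>
           - (- \<tau>) ^ (a - 2) * calE (2 - int a) (- of_real \<alpha> / \<tau> + of_real \<beta>) (- 1 / \<tau>)
         = (2 * of_real pi * \<i>) ^ (a - 1) *
             (\<Sum>n=0..a. (- 1) ^ n * Bernoulli_poly n (of_real \<beta>) * Bernoulli_poly (a - n) (of_real \<alpha>)
                           / (fact n * fact (a - n)) * \<tau> powi (int n - 1))"
    (is "?E1 - _ * ?E2 = _ * ?S")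
proof -
  let ?c = "2 * of_real pi * \<i> :: complex"
  \<comment> \<open>The periods are p = 1 and r, so that w / r = -\<tau> w.\<close>
  define r where "r = - 1 / \<tau>"
  have \<tau>: "\<tau> \<noteq> 0" and r: "r \<noteq> 0" "1 / r = - \<tau>" using assms by (auto simp: r_def)
  have sum1: "(\<Sum>\<^sub>\<infinity>n\<in>UNIV - {0}. lattice_residue a \<alpha> \<beta> 1 r n) = - (?c * \<tau>) * ?E1"
  proof -
    have "lattice_kernel \<beta> (of_int n / r) = lattice_kernel (1 - \<beta>) (of_int n * \<tau>)" for n :: int
      using lattice_kernel_minus[of \<beta> "of_int n * \<tau>"] \<tau> by (simp add: r_def)
    thus ?thesis
      using calE_eq_lattice_kernel_sum[of a \<tau> "1 - \<beta>" \<alpha>] assms(1) \<tau>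
      by (simp add: lattice_residue_def)
  qed
  have sum2: "(\<Sum>\<^sub>\<infinity>n\<in>UNIV - {0}. lattice_residue a \<beta> \<alpha> r 1 n) = - (?c * (- \<tau>) ^ (a - 1)) * ?E2"
  proof -
    have "(\<Sum>\<^sub>\<infinity>n\<in>UNIV - {0}. lattice_residue a \<beta> \<alpha> r 1 n) =
        (\<Sum>\<^sub>\<infinity>n\<in>UNIV - {0}. (1 / r ^ a) *
           (exp (?c * \<beta> * of_int n) * lattice_kernel \<alpha> (of_int n * r) / of_int n ^ a))"
      by (simp add: lattice_residue_def power_mult_distrib mult_ac)
    also have "\<dots> = (1 / r ^ a) * (- (?c * r) * calE (2 - int a) (\<alpha> * r + \<beta>) r)"
      using calE_eq_lattice_kernel_sum[of a r \<alpha> \<beta>] assms(1) r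
      by (subst infsum_cmult_right') simp
    also have "\<dots> = - (?c * (r / r ^ a)) * calE (2 - int a) (\<alpha> * r + \<beta>) r"
      by simp
    \<comment> \<open>This is the source of the automorphy factor: 1 / r = -\<tau>, and one further
      power is lost when the identity is divided by 2 pi i \<tau>.\<close>
    also have "r / r ^ a = (1 / r) ^ (a - 1)"
      using assms(1) r(1) by (cases a) (auto simp: power_one_over)
    finally show ?thesis unfolding r(2) by (simp add: r_def)
  qed
  have "Im (1 / r) \<noteq> 0" using assms r by simp
  note sum = lattice_residue_sum[OF assms(1-5) this, unfolded sum1 sum2]
  have "?c * \<tau> * ?E1 + ?c * (- \<tau>) ^ (a - 1) * ?E2 =
      - (- (?c * \<tau>) * ?E1 + - (?c * (- \<tau>) ^ (a - 1)) * ?E2)"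
    by (simp only: minus_add_distrib mult_minus_left minus_minus)
  also have "\<dots> = (\<Sum>n=0..a. (?c / r) ^ n * Bernoulli_poly n (of_real \<beta>) / fact n *
            ((?c / 1) ^ (a - n) * Bernoulli_poly (a - n) (of_real \<alpha>) / fact (a - n)))"
    unfolding sum by (rule minus_minus)
  also have "\<dots> = ?c ^ a * \<tau> * ?S"
    unfolding sum_distrib_left
  proof (intro sum.cong refl)
    fix n assume n: "n \<in> {0..a}"
    \<comment> \<open>The sign \<open>(- 1) ^ n\<close> and the power of \<tau> both come from 1 / r
      = -\<tau>. One factor \<tau> is then pulled out, which leaves the exponent n - 1, negative for
      n = 0.\<close>
    have "?c / r = - 1 * \<tau> * ?c" using \<tau> by (simp add: r_def)
    hence "(?c / r) ^ n * (?c / 1) ^ (a - n) = (- 1) ^ n * \<tau> ^ n * (?c ^ n * ?c ^ (a - n))"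
      by (simp only: power_mult_distrib div_by_1 mult_ac)
    also have "?c ^ n * ?c ^ (a - n) = ?c ^ a"
      using n by (simp flip: power_add)
    also have "\<tau> ^ n = \<tau> * \<tau> powi (int n - 1)"
      using \<tau> by (simp add: power_int_diff)
    finally have *: "(?c / r) ^ n * (?c / 1) ^ (a - n) = (- 1) ^ n * (\<tau> * \<tau> powi (int n - 1)) * ?c ^ a" .
    let ?x = "Bernoulli_poly n (of_real \<beta> :: complex)" and ?y = "Bernoulli_poly (a - n) (of_real \<alpha> :: complex)"
    have "(?c / r) ^ n * ?x / fact n * ((?c / 1) ^ (a - n) * ?y / fact (a - n)) =
        ((?c / r) ^ n * (?c / 1) ^ (a - n)) * (?x * ?y / (fact n * fact (a - n)))"
      by simp
    also have "\<dots> = ?c ^ a * \<tau> * ((- 1) ^ n * ?x * ?y / (fact n * fact (a - n)) * \<tau> powi (int n - 1))"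
      unfolding * by simp
    finally show "(?c / r) ^ n * ?x / fact n * ((?c / 1) ^ (a - n) * ?y / fact (a - n)) = \<dots>" .
  qed
  also have "?c ^ a = ?c * ?c ^ (a - 1)" using assms(1) by (cases a) auto
  also have "(- \<tau>) ^ (a - 1) = - \<tau> * (- \<tau>) ^ (a - 2)"
    using assms(1) by (metis Suc_diff_Suc Suc_1 Suc_le_lessD power_Suc)
  finally have eq: "?c * \<tau> * ?E1 + ?c * (- \<tau> * (- \<tau>) ^ (a - 2)) * ?E2 = ?c * ?c ^ (a - 1) * \<tau> * ?S" .
  \<comment> \<open>Collects the common factor 2 pi i \<tau>, which is nonzero and is cancelled at
    the end.\<close>
  have alg: "c * t * (E - u * F) = c * t * (k * S)" if "c * t * E + c * (- t * u) * F = c * k * t * S"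
    for c t u k E F S :: complex
    using that by (simp add: algebra_simps)
  have "?c * \<tau> * (?E1 - (- \<tau>) ^ (a - 2) * ?E2) = ?c * \<tau> * (?c ^ (a - 1) * ?S)"
    by (rule alg[OF eq])
  thus ?thesis using \<tau> by (subst (asm) mult_cancel_left) auto
qed

end
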